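(* Let $M$ and $N$ be commutative monoids and let $\varphi : M \to N$ be a monoid homomorphism. Then the map $$\varphi^\ast : \mathrm{Filt}\,N \to \mathrm{Filt}\,M,\qquad F \mapsto \varphi^{-1}(F)$$ is (well defined and) continuous. With this assignment on morphisms, $M \mapsto \mathrm{Filt}\,M$ is a contravariant functor from the category of commutative monoids to the category of topological spaces.
   Context: Let $M$ be a commutative monoid, written multiplicatively with neutral element $1$; $g$ divides $f$ if $f = g\cdot a$ for some $a\in M$. A filter in $M$ is a subset $F \subseteq M$ such that (1) $1\in F$; (2) $f,g\in F$ implies $f\cdot g\in F$; (3) if $f\in F$ and $g$ divides $f$, then $g\in F$. (The whole monoid is allowed as a filter.) $\mathrm{Filt}\,M$ denotes the set of all filters of $M$ with the topology having as basis the sets $D(f) = \{F \in \mathrm{Filt}\,M : f\in F\}$, $f\in M$. *)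

theory Defs
  imports "HOL-Algebra.Divisibility" "HOL-Analysis.Abstract_Topology"
begin

section \<open>Monoid homomorphisms\<close>

text \<open>The library's \<^const>\<open>hom\<close> only asks for compatibility with multiplication, which for
  monoids does not imply preservation of the neutral element.\<close>

definition monoid_homs ::
  "('a, 'm) monoid_scheme \<Rightarrow> ('b, 'n) monoid_scheme \<Rightarrow> ('a \<Rightarrow> 'b) set"
  where "monoid_homs M N = {\<phi> \<in> hom M N. \<phi> \<one>\<^bsub>M\<^esub> = \<one>\<^bsub>N\<^esub>}"


section \<open>The filter space of a commutative monoid\<close>

definition monoid_filter :: "('a, 'm) monoid_scheme \<Rightarrow> 'a set \<Rightarrow> bool"
  where "monoid_filter M F \<longleftrightarrow>
    F \<subseteq> carrier M \<and>
    \<one>\<^bsub>M\<^esub> \<in> F \<and>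
    (\<forall>f\<in>F. \<forall>g\<in>F. f \<otimes>\<^bsub>M\<^esub> g \<in> F) \<and>
    (\<forall>f\<in>F. \<forall>g\<in>carrier M. g divides\<^bsub>M\<^esub> f \<longrightarrow> g \<in> F)"

definition Filt :: "('a, 'm) monoid_scheme \<Rightarrow> 'a set set"
  where "Filt M = {F. monoid_filter M F}"

definition filt_basic :: "('a, 'm) monoid_scheme \<Rightarrow> 'a \<Rightarrow> 'a set set"
  where "filt_basic M f = {F \<in> Filt M. f \<in> F}"

definition filt_space :: "('a, 'm) monoid_scheme \<Rightarrow> 'a set topology"
  where "filt_space M = topology (arbitrary union_of (\<lambda>U. \<exists>f\<in>carrier M. U = filt_basic M f))"

lemma filt_basic_Int:
  assumes "comm_monoid M" "f \<in> carrier M" "g \<in> carrier M"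
  shows "filt_basic M f \<inter> filt_basic M g = filt_basic M (f \<otimes>\<^bsub>M\<^esub> g)"
proof -
  interpret comm_monoid M by fact
  have "f divides\<^bsub>M\<^esub> f \<otimes>\<^bsub>M\<^esub> g" "g divides\<^bsub>M\<^esub> f \<otimes>\<^bsub>M\<^esub> g"
    using assms m_comm by (auto simp: factor_def)
  then show ?thesis
    using assms by (auto simp: filt_basic_def Filt_def monoid_filter_def)
qed

text \<open>The function \<^const>\<open>topology\<close> is only meaningful on families satisfying
  \<^const>\<open>istopology\<close>; the following two lemmas record that this is the case here.\<close>

lemma openin_filt_space:
  assumes "comm_monoid M"
  shows "openin (filt_space M) =
    arbitrary union_of (\<lambda>U. \<exists>f\<in>carrier M. U = filt_basic M f)"
proof -
  interpret comm_monoid M by fact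
  have "istopology (arbitrary union_of (\<lambda>U. \<exists>f\<in>carrier M. U = filt_basic M f))"
    unfolding istopology_base_eq
    by (metis (mono_tags, lifting) arbitrary_union_of_inc assms filt_basic_Int m_closed)
  then show ?thesis
    by (simp add: filt_space_def)
qed

lemma topspace_filt_space:
  assumes "comm_monoid M"
  shows "topspace (filt_space M) = Filt M"
proof
  interpret comm_monoid M by fact
  show "topspace (filt_space M) \<subseteq> Filt M"
    unfolding topspace_def openin_filt_space[OF assms]
    by (fastforce simp: union_of_def arbitrary_def filt_basic_def)
  have "Filt M = filt_basic M \<one>\<^bsub>M\<^esub>"
    by (auto simp: filt_basic_def Filt_def monoid_filter_def)
  moreover have "openin (filt_space M) (filt_basic M \<one>\<^bsub>M\<^esub>)"
    unfolding openin_filt_space[OF assms] by (rule arbitrary_union_of_inc) auto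
  ultimately show "Filt M \<subseteq> topspace (filt_space M)"
    using openin_subset by metis
qed

definition filt_pullback :: "('a, 'm) monoid_scheme \<Rightarrow> ('a \<Rightarrow> 'b) \<Rightarrow> 'b set \<Rightarrow> 'a set"
  where "filt_pullback M \<phi> F = \<phi> -` F \<inter> carrier M"


section \<open>Categories and contravariant functors\<close>

text \<open>Hom-sets are indexed by source and target and need not be disjoint, so identities,
  composition and the action of functors on morphisms take the objects as arguments:
  \<open>cat_comp C X Y Z g f\<close> is the composite of \<open>f : X \<rightarrow> Y\<close> and \<open>g : Y \<rightarrow> Z\<close>.\<close>

record ('o, 'm) cat =
  cat_obj :: "'o set"
  cat_hom :: "'o \<Rightarrow> 'o \<Rightarrow> 'm set"
  cat_id :: "'o \<Rightarrow> 'm"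
  cat_comp :: "'o \<Rightarrow> 'o \<Rightarrow> 'o \<Rightarrow> 'm \<Rightarrow> 'm \<Rightarrow> 'm"

locale category =
  fixes C :: "('o, 'm) cat"
  assumes id_in_hom: "X \<in> cat_obj C \<Longrightarrow> cat_id C X \<in> cat_hom C X X"
    and comp_in_hom:
      "\<lbrakk>X \<in> cat_obj C; Y \<in> cat_obj C; Z \<in> cat_obj C; f \<in> cat_hom C X Y; g \<in> cat_hom C Y Z\<rbrakk>
       \<Longrightarrow> cat_comp C X Y Z g f \<in> cat_hom C X Z"
    and comp_id_right:
      "\<lbrakk>X \<in> cat_obj C; Y \<in> cat_obj C; f \<in> cat_hom C X Y\<rbrakk>
       \<Longrightarrow> cat_comp C X X Y f (cat_id C X) = f"
    and comp_id_left:
      "\<lbrakk>X \<in> cat_obj C; Y \<in> cat_obj C; f \<in> cat_hom C X Y\<rbrakk>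
       \<Longrightarrow> cat_comp C X Y Y (cat_id C Y) f = f"
    and comp_assoc:
      "\<lbrakk>W \<in> cat_obj C; X \<in> cat_obj C; Y \<in> cat_obj C; Z \<in> cat_obj C;
        f \<in> cat_hom C W X; g \<in> cat_hom C X Y; h \<in> cat_hom C Y Z\<rbrakk>
       \<Longrightarrow> cat_comp C W Y Z h (cat_comp C W X Y g f)
         = cat_comp C W X Z (cat_comp C X Y Z h g) f"

text \<open>\<open>fmap X Y f : fobj Y \<rightarrow> fobj X\<close> is the image of \<open>f : X \<rightarrow> Y\<close>.\<close>

locale contravariant_functor = C: category C + D: category D
  for C :: "('o, 'm) cat" and D :: "('p, 'n) cat" +
  fixes fobj :: "'o \<Rightarrow> 'p" and fmap :: "'o \<Rightarrow> 'o \<Rightarrow> 'm \<Rightarrow> 'n"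
  assumes fobj_in_obj: "X \<in> cat_obj C \<Longrightarrow> fobj X \<in> cat_obj D"
    and fmap_in_hom:
      "\<lbrakk>X \<in> cat_obj C; Y \<in> cat_obj C; f \<in> cat_hom C X Y\<rbrakk>
       \<Longrightarrow> fmap X Y f \<in> cat_hom D (fobj Y) (fobj X)"
    and fmap_id: "X \<in> cat_obj C \<Longrightarrow> fmap X X (cat_id C X) = cat_id D (fobj X)"
    and fmap_comp:
      "\<lbrakk>X \<in> cat_obj C; Y \<in> cat_obj C; Z \<in> cat_obj C; f \<in> cat_hom C X Y; g \<in> cat_hom C Y Z\<rbrakk>
       \<Longrightarrow> fmap X Z (cat_comp C X Y Z g f)
         = cat_comp D (fobj Z) (fobj Y) (fobj X) (fmap X Y f) (fmap Y Z g)"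


section \<open>The categories of commutative monoids and of topological spaces\<close>

text \<open>The type variable plays the role of the universe.  Morphisms are extensional functions,
  so that equality of morphisms is equality on the underlying set of the source.\<close>

definition comm_monoid_cat :: "('a monoid, 'a \<Rightarrow> 'a) cat"
  where "comm_monoid_cat =
    \<lparr>cat_obj = {M. comm_monoid M},
     cat_hom = (\<lambda>M N. monoid_homs M N \<inter> extensional (carrier M)),
     cat_id = (\<lambda>M. \<lambda>x\<in>carrier M. x),
     cat_comp = (\<lambda>M N P \<psi> \<phi>. compose (carrier M) \<psi> \<phi>)\<rparr>"

definition top_cat :: "('a topology, 'a \<Rightarrow> 'a) cat"
  where "top_cat =
    \<lparr>cat_obj = UNIV,
     cat_hom = (\<lambda>X Y. {f. continuous_map X Y f} \<inter> extensional (topspace X)),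
     cat_id = (\<lambda>X. \<lambda>x\<in>topspace X. x),
     cat_comp = (\<lambda>X Y Z g f. compose (topspace X) g f)\<rparr>"

definition filt_map ::
  "('a, 'm) monoid_scheme \<Rightarrow> ('b, 'n) monoid_scheme \<Rightarrow> ('a \<Rightarrow> 'b) \<Rightarrow> 'b set \<Rightarrow> 'a set"
  where "filt_map M N \<phi> = (\<lambda>F\<in>Filt N. filt_pullback M \<phi> F)"

end

theory Submission
  imports Defs
begin

text \<open>A homomorphism preserves the neutral element, products and divisibility, and these are
  the three closure conditions of a filter; hence preimages of filters are filters
  (\<open>filt_pullback_in_Filt\<close>).  The preimage of the basic open set $D(f)$ under $\varphi^*$ is
  again a basic open set, namely $D(\varphi(f))$, because $f \in \varphi^{-1}(F)$ means
  $\varphi(f) \in F$ (\<open>filt_pullback_vimage_basic\<close>); this gives continuity.  Functoriality is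
  that of taking preimages.  What remains is to pass to extensional functions: a pullback sees
  only the values of $\varphi$ on the carrier (\<open>filt_pullback_restrict\<close>), so restricting
  identities and composites to carriers changes nothing.\<close>

lemma monoid_homs_closed:
  assumes "\<phi> \<in> monoid_homs M N" "x \<in> carrier M"
  shows "\<phi> x \<in> carrier N"
  using assms by (auto simp: monoid_homs_def hom_def)

lemma monoid_homs_divides:
  assumes "\<phi> \<in> monoid_homs M N" "g \<in> carrier M" "g divides\<^bsub>M\<^esub> f"
  shows "\<phi> g divides\<^bsub>N\<^esub> \<phi> f"
  using assms by (auto simp: monoid_homs_def hom_def factor_def)

lemma monoid_homs_id:
  assumes "comm_monoid M"
  shows "(\<lambda>x\<in>carrier M. x) \<in> monoid_homs M M"
proof -
  interpret comm_monoid M by fact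
  show ?thesis by (auto simp: monoid_homs_def hom_def)
qed

lemma monoid_homs_compose:
  assumes "comm_monoid M" "\<phi> \<in> monoid_homs M N" "\<psi> \<in> monoid_homs N P"
  shows "compose (carrier M) \<psi> \<phi> \<in> monoid_homs M P"
proof -
  interpret comm_monoid M by fact
  show ?thesis
    using assms(2,3) by (auto simp: monoid_homs_def hom_def compose_def Pi_iff)
qed

lemma category_comm_monoid_cat: "category comm_monoid_cat"
proof
  fix M N P :: "'a monoid" and \<phi> \<psi>
  assume "M \<in> cat_obj comm_monoid_cat"
    "\<phi> \<in> cat_hom comm_monoid_cat M N" "\<psi> \<in> cat_hom comm_monoid_cat N P"
  then show "cat_comp comm_monoid_cat M N P \<psi> \<phi> \<in> cat_hom comm_monoid_cat M P"
    by (auto simp: comm_monoid_cat_def intro: monoid_homs_compose)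
next
  fix M :: "'a monoid"
  assume "M \<in> cat_obj comm_monoid_cat"
  then show "cat_id comm_monoid_cat M \<in> cat_hom comm_monoid_cat M M"
    by (simp add: comm_monoid_cat_def monoid_homs_id)
qed (auto simp: comm_monoid_cat_def compose_def restrict_def extensional_def
    monoid_homs_closed fun_eq_iff)

lemma top_cat_simps:
  "cat_obj top_cat = UNIV"
  "cat_id top_cat X = (\<lambda>x\<in>topspace X. x)"
  "cat_comp top_cat X Y Z g f = compose (topspace X) g f"
  by (simp_all add: top_cat_def)

lemma category_top_cat: "category top_cat"
proof
  fix X Y Z :: "'a topology" and f g
  assume "f \<in> cat_hom top_cat X Y" "g \<in> cat_hom top_cat Y Z"
  then have "continuous_map X Z (g \<circ> f)"
    by (auto simp: top_cat_def intro: continuous_map_compose)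
  then have "continuous_map X Z (compose (topspace X) g f)"
    by (rule continuous_map_eq) (simp add: compose_def)
  then show "cat_comp top_cat X Y Z g f \<in> cat_hom top_cat X Z"
    by (simp add: top_cat_def compose_extensional)
next
  fix X :: "'a topology"
  have "continuous_map X X (\<lambda>x\<in>topspace X. x)"
    using continuous_map_id by (rule continuous_map_eq) simp
  then show "cat_id top_cat X \<in> cat_hom top_cat X X"
    by (simp add: top_cat_def)
qed (auto simp: top_cat_def compose_def restrict_def extensional_def fun_eq_iff
    dest: continuous_map_image_subset_topspace)

text \<open>Closure under divisors is where the homomorphism must preserve divisibility: if $g$ divides
  $f$ and $\varphi(f) \in F$, then $\varphi(g)$ divides an element of $F$.  The condition
  $\varphi(1) = 1$ puts the neutral element in the preimage.\<close>

lemma filt_pullback_in_Filt: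
  assumes "comm_monoid M" "\<phi> \<in> monoid_homs M N" "F \<in> Filt N"
  shows "filt_pullback M \<phi> F \<in> Filt M"
proof -
  interpret comm_monoid M by fact
  have hom: "\<phi> \<one>\<^bsub>M\<^esub> = \<one>\<^bsub>N\<^esub>"
    "\<And>f g. f \<in> carrier M \<Longrightarrow> g \<in> carrier M \<Longrightarrow> \<phi> (f \<otimes>\<^bsub>M\<^esub> g) = \<phi> f \<otimes>\<^bsub>N\<^esub> \<phi> g"
    using assms(2) by (auto simp: monoid_homs_def hom_def)
  show ?thesis
    using assms(3) monoid_homs_closed[OF assms(2)] monoid_homs_divides[OF assms(2)]
    by (auto simp: Filt_def monoid_filter_def filt_pullback_def hom)
qed

lemma filt_pullback_vimage_basic:
  assumes "comm_monoid M" "\<phi> \<in> monoid_homs M N" "f \<in> carrier M"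
  shows "{F \<in> Filt N. filt_pullback M \<phi> F \<in> filt_basic M f} = filt_basic N (\<phi> f)"
  using assms filt_pullback_in_Filt[OF assms(1,2)]
  by (auto simp: filt_basic_def filt_pullback_def)

lemma openin_filt_basic:
  assumes "comm_monoid M" "f \<in> carrier M"
  shows "openin (filt_space M) (filt_basic M f)"
  unfolding openin_filt_space[OF assms(1)] using assms(2) by (intro arbitrary_union_of_inc) auto

lemma continuous_map_filt_pullback:
  assumes "comm_monoid M" "comm_monoid N" "\<phi> \<in> monoid_homs M N"
  shows "continuous_map (filt_space N) (filt_space M) (filt_pullback M \<phi>)"
proof (rule continuous_map_into_topology_base[OF openin_filt_space[OF assms(1)]])
  show "filt_pullback M \<phi> F \<in> topspace (filt_space M)" if "F \<in> topspace (filt_space N)" for F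
    using that assms by (simp add: topspace_filt_space filt_pullback_in_Filt)
  show "openin (filt_space N) {F \<in> topspace (filt_space N). filt_pullback M \<phi> F \<in> U}"
    if "\<exists>f\<in>carrier M. U = filt_basic M f" for U
    using that assms
    by (auto simp: topspace_filt_space filt_pullback_vimage_basic openin_filt_basic
        monoid_homs_closed)
qed

lemma filt_pullback_id:
  assumes "F \<in> Filt M"
  shows "filt_pullback M (\<lambda>x. x) F = F"
  using assms by (auto simp: filt_pullback_def Filt_def monoid_filter_def)

lemma filt_pullback_comp:
  assumes "\<phi> \<in> monoid_homs M N"
  shows "filt_pullback M (\<psi> \<circ> \<phi>) F = filt_pullback M \<phi> (filt_pullback N \<psi> F)"
  using monoid_homs_closed[OF assms] by (auto simp: filt_pullback_def)

text \<open>This removes the restrictions to carriers that identities and composites carry in the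
  category of monoids, so that functoriality reduces to the identities for plain preimages.\<close>

lemma filt_pullback_restrict:
  "filt_pullback M (restrict \<phi> (carrier M)) = filt_pullback M \<phi>"
  by (auto simp: filt_pullback_def fun_eq_iff)

lemma filt_map_in_hom:
  assumes "comm_monoid M" "comm_monoid N" "\<phi> \<in> monoid_homs M N"
  shows "filt_map M N \<phi> \<in> cat_hom top_cat (filt_space N) (filt_space M)"
proof -
  have "continuous_map (filt_space N) (filt_space M) (filt_map M N \<phi>)"
    using continuous_map_filt_pullback[OF assms]
    by (rule continuous_map_eq) (simp add: filt_map_def topspace_filt_space assms(2))
  then show ?thesis
    by (simp add: top_cat_def topspace_filt_space assms(2) filt_map_def)
qed

lemma filt_map_id:
  "filt_map M M (\<lambda>x\<in>carrier M. x) = (\<lambda>F\<in>Filt M. F)"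
  by (simp add: filt_map_def filt_pullback_restrict filt_pullback_id cong: restrict_cong)

lemma filt_map_comp:
  assumes "comm_monoid N" "\<phi> \<in> monoid_homs M N" "\<psi> \<in> monoid_homs N P"
  shows "filt_map M P (compose (carrier M) \<psi> \<phi>)
    = compose (Filt P) (filt_map M N \<phi>) (filt_map N P \<psi>)"
proof
  fix F
  have "compose (carrier M) \<psi> \<phi> = restrict (\<psi> \<circ> \<phi>) (carrier M)"
    by (simp add: compose_def comp_def)
  then show "filt_map M P (compose (carrier M) \<psi> \<phi>) F
      = compose (Filt P) (filt_map M N \<phi>) (filt_map N P \<psi>) F"
    using filt_pullback_in_Filt[OF assms(1,3)]
    by (simp add: filt_map_def compose_def filt_pullback_restrict filt_pullback_comp[OF assms(2)])
qed

lemma contravariant_functor_filt: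
  "contravariant_functor comm_monoid_cat top_cat filt_space filt_map"
proof (intro contravariant_functor.intro contravariant_functor_axioms.intro
    category_comm_monoid_cat category_top_cat)
qed (auto simp: filt_map_in_hom comm_monoid_cat_def filt_map_id filt_map_comp
    topspace_filt_space top_cat_simps)

theorem mainTheorem1:
  fixes M :: "('a, 'm) monoid_scheme"
    and N :: "('b, 'n) monoid_scheme"
    and P :: "('c, 'p) monoid_scheme"
    and \<phi> :: "'a \<Rightarrow> 'b" and \<psi> :: "'b \<Rightarrow> 'c"
  assumes "comm_monoid M" and "comm_monoid N" and "\<phi> \<in> monoid_homs M N"
  shows "(\<forall>F \<in> Filt N. filt_pullback M \<phi> F \<in> Filt M)
    \<and> continuous_map (filt_space N) (filt_space M) (filt_pullback M \<phi>)
    \<and> (\<forall>F \<in> Filt M. filt_pullback M (\<lambda>x. x) F = F)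
    \<and> (comm_monoid P \<and> \<psi> \<in> monoid_homs N P \<longrightarrow>
        (\<forall>F \<in> Filt P. filt_pullback M (\<psi> \<circ> \<phi>) F = filt_pullback M \<phi> (filt_pullback N \<psi> F)))
    \<and> contravariant_functor
        (comm_monoid_cat :: ('u monoid, 'u \<Rightarrow> 'u) cat)
        (top_cat :: ('u set topology, 'u set \<Rightarrow> 'u set) cat)
        filt_space filt_map"
  using assms
  by (simp add: filt_pullback_in_Filt continuous_map_filt_pullback filt_pullback_id
      filt_pullback_comp contravariant_functor_filt)

end
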